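(* Let $T_2=\lambda n\lambda f(((n)f)F)\underline{0}$, where $F=\lambda x\lambda y(x)(\underline{s})y$. Let $u\in N_{x,f}$ be without free $\mu$-variables and such that $\mathrm{val}(u)=\{n\}$, and let $\theta=\lambda x\lambda f\,u$. Then $((T_2)\theta)f\succ(f)(\underline{s})^n\underline{0}$ (where the outer $f$ is a free $\lambda$-variable).
   Context: **$\lambda\mu$-terms.** There are two disjoint alphabets of variables: $\lambda$-variables $x,y,z,\dots$ and $\mu$-variables $\alpha,\beta,\gamma,\dots$. Terms are generated by: a $\lambda$-variable $x$; $\lambda x\,u$; application $(u)v$; and $\mu\alpha[\beta]t$ ($\alpha,\beta$ $\mu$-variables, possibly equal, $t$ a term). $\lambda x$ binds $x$ and $\mu\alpha$ binds $\alpha$. An expression $[\alpha]t$ is called a named term. Terms are considered up to renaming of bound variables; in each term the free and bound variables are assumed distinct and each bound variable is bound only once. Below, in $\mu\alpha u$, $u$ denotes a named term. Application notation: $(a)(b)c$ means $(a)((b)c)$, and $(a)^n b$ is $(a)(a)\cdots(a)b$ ($n$ times). **Reduction.** Computation rules: $(C_1)$ $(\lambda x u)v\to u[v/x]$; $(C_2)$ $(\mu\alpha u)v\to\mu\alpha\,u[v/{*}\alpha]$, where $u[v/{*}\alpha]$ is obtained by inductively replacing each subterm $[\alpha]w$ of $u$ by $[\alpha](w)v$. Simplification rules: $(S_1)$ $[\alpha]\mu\beta u\to u[\alpha/\beta]$; $(S_2)$ $\mu\alpha[\alpha]u\to u$ if $\alpha$ is not free in $u$; $(S_3)$ $\mu\alpha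 u\to\lambda x\mu\alpha\,u[x/{*}\alpha]$ ($x$ fresh) if $u$ contains a subterm of the form $[\alpha]\lambda y w$. **Head reduction.** The set $H$ of head normal forms is defined inductively: $\lambda$-variables are in $H$; if $u\in H$ then $\lambda xu\in H$; if $u\in H$ and $(u)v$ is not a redex then $(u)v\in H$; if $u\in H$ and $\mu\alpha[\beta]u$ is not a redex then $\mu\alpha[\beta]u\in H$. A head reduction is a sequence $t_1,\dots,t_k$ such that for all $1\le i\le k-1$, $t_i$ is not in head normal form and $t_{i+1}$ is obtained from $t_i$ by reducing the leftmost redex. Write $t\succ u$ if $u$ is obtained from $t$ by a head reduction. **Integers.** $\underline{0}=\lambda x\lambda f\,x$ and $\underline{s}=\lambda n\lambda x\lambda f(f)((n)x)f$. **The set $N_{x,f}$.** Fix two $\lambda$-variables $x,f$. $N_{x,f}$ is the smallest set of $\lambda\mu$-terms with: $x\in N_{x,f}$; $\mu\alpha[\beta]x\in N_{x,f}$; if $u\in N_{x,f}$ then $(f)u\in N_{x,f}$ and $\mu\alpha[\beta](f)u\in N_{x,f}$ (for all $\mu$-variables $\alpha,\beta$). **The set $\mathrm{val}(u)$**, defined inductively for $u\in N_{x,f}$ (and its subterms): $\mathrm{val}(x)=\{0\}$; $\mathrm{val}((f)u)=\{n+1: n\in\mathrm{val}(u)\}$; $\mathrm{val}(\mu\alpha[\beta]u)=\bigcup\mathrm{val}(v)$, the union over all subterms $[\alpha]v$ of $[\beta]u$ (including $[\beta]u$ itself if $\beta=\alpha$; an empty union is $\emptyset$).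
   Formalization: Head normal forms here also exclude μα[β]u when [β]u is an S1-redex; without this, u=μa[a](f)μc[a]x (val {0}) would stop at μa[a]μc[a](f)0 and the claim would fail. *)

theory Defs
  imports Main
begin

text \<open>
  Terms up to renaming of bound variables, with separate de Bruijn indices for the two
  alphabets: \<^term>\<open>Lam\<close> binds \<open>\<lambda>\<close>-index 0 and \<^term>\<open>Mu\<close> binds \<open>\<mu>\<close>-index 0, and neither
  binder shifts the indices of the other alphabet.  The term \<open>\<mu>\<alpha>[\<beta>]t\<close> is
  \<open>Mu (Named \<beta> t)\<close> and \<open>(t)u\<close> is \<open>App t u\<close>.
\<close>

datatype trm = LVar nat | Lam trm | App trm trm | Mu cmd
and cmd = Named nat trm

primrec lift_trm :: "nat \<Rightarrow> trm \<Rightarrow> trm" and lift_cmd :: "nat \<Rightarrow> cmd \<Rightarrow> cmd" where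
  "lift_trm k (LVar i) = LVar (if i < k then i else Suc i)"
| "lift_trm k (Lam t) = Lam (lift_trm (Suc k) t)"
| "lift_trm k (App t u) = App (lift_trm k t) (lift_trm k u)"
| "lift_trm k (Mu c) = Mu (lift_cmd k c)"
| "lift_cmd k (Named b t) = Named b (lift_trm k t)"

primrec mlift_trm :: "nat \<Rightarrow> trm \<Rightarrow> trm" and mlift_cmd :: "nat \<Rightarrow> cmd \<Rightarrow> cmd" where
  "mlift_trm k (LVar i) = LVar i"
| "mlift_trm k (Lam t) = Lam (mlift_trm k t)"
| "mlift_trm k (App t u) = App (mlift_trm k t) (mlift_trm k u)"
| "mlift_trm k (Mu c) = Mu (mlift_cmd (Suc k) c)"
| "mlift_cmd k (Named b t) = Named (if b < k then b else Suc b) (mlift_trm k t)"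

text \<open>\<open>u[v/k]\<close> for a \<open>\<lambda>\<close>-index \<open>k\<close> whose binder is removed.\<close>

primrec subst_trm :: "trm \<Rightarrow> trm \<Rightarrow> nat \<Rightarrow> trm" and subst_cmd :: "cmd \<Rightarrow> trm \<Rightarrow> nat \<Rightarrow> cmd" where
  "subst_trm (LVar i) v k = (if i < k then LVar i else if i = k then v else LVar (i - 1))"
| "subst_trm (Lam t) v k = Lam (subst_trm t (lift_trm 0 v) (Suc k))"
| "subst_trm (App t u) v k = App (subst_trm t v k) (subst_trm u v k)"
| "subst_trm (Mu c) v k = Mu (subst_cmd c (mlift_trm 0 v) k)"
| "subst_cmd (Named b t) v k = Named b (subst_trm t v k)"

text \<open>\<open>u[a/k]\<close> for a \<open>\<mu>\<close>-index \<open>k\<close> whose binder is removed.\<close>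

primrec rename_trm :: "trm \<Rightarrow> nat \<Rightarrow> nat \<Rightarrow> trm" and rename_cmd :: "cmd \<Rightarrow> nat \<Rightarrow> nat \<Rightarrow> cmd" where
  "rename_trm (LVar i) a k = LVar i"
| "rename_trm (Lam t) a k = Lam (rename_trm t a k)"
| "rename_trm (App t u) a k = App (rename_trm t a k) (rename_trm u a k)"
| "rename_trm (Mu c) a k = Mu (rename_cmd c (Suc a) (Suc k))"
| "rename_cmd (Named b t) a k =
     Named (if b < k then b else if b = k then a else b - 1) (rename_trm t a k)"

text \<open>\<open>u[v/*a]\<close>: each subterm \<open>[a]w\<close> becomes \<open>[a](w)v\<close>.  The \<open>\<mu>\<close>-variable \<open>a\<close> persists,
  so \<open>v\<close> has to live in the same scope as \<open>u\<close>.\<close>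

primrec structsubst_trm :: "trm \<Rightarrow> trm \<Rightarrow> nat \<Rightarrow> trm"
    and structsubst_cmd :: "cmd \<Rightarrow> trm \<Rightarrow> nat \<Rightarrow> cmd" where
  "structsubst_trm (LVar i) v a = LVar i"
| "structsubst_trm (Lam t) v a = Lam (structsubst_trm t (lift_trm 0 v) a)"
| "structsubst_trm (App t u) v a = App (structsubst_trm t v a) (structsubst_trm u v a)"
| "structsubst_trm (Mu c) v a = Mu (structsubst_cmd c (mlift_trm 0 v) (Suc a))"
| "structsubst_cmd (Named b t) v a =
     Named b (if b = a then App (structsubst_trm t v a) v else structsubst_trm t v a)"

primrec fmv_trm :: "trm \<Rightarrow> nat set" and fmv_cmd :: "cmd \<Rightarrow> nat set" where
  "fmv_trm (LVar i) = {}"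
| "fmv_trm (Lam t) = fmv_trm t"
| "fmv_trm (App t u) = fmv_trm t \<union> fmv_trm u"
| "fmv_trm (Mu c) = {a. Suc a \<in> fmv_cmd c}"
| "fmv_cmd (Named b t) = insert b (fmv_trm t)"

text \<open>The terms \<open>v\<close> such that \<open>[a]v\<close> is a subterm.  Each \<open>v\<close> is returned as it stands, i.e.
  with indices relative to its own position.\<close>

primrec named_trm :: "nat \<Rightarrow> trm \<Rightarrow> trm set" and named_cmd :: "nat \<Rightarrow> cmd \<Rightarrow> trm set" where
  "named_trm a (LVar i) = {}"
| "named_trm a (Lam t) = named_trm a t"
| "named_trm a (App t u) = named_trm a t \<union> named_trm a u"
| "named_trm a (Mu c) = named_cmd (Suc a) c"
| "named_cmd a (Named b t) = (if b = a then {t} else {}) \<union> named_trm a t"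

text \<open>In \<open>S2\<close> the index 0 does not occur in \<open>u\<close>, so the renaming merely lowers the other
  \<open>\<mu>\<close>-indices.\<close>

inductive contract_trm :: "trm \<Rightarrow> trm \<Rightarrow> bool" where
  C1: "contract_trm (App (Lam u) v) (subst_trm u v 0)"
| C2: "contract_trm (App (Mu c) v) (Mu (structsubst_cmd c (mlift_trm 0 v) 0))"
| S2: "0 \<notin> fmv_trm u \<Longrightarrow> contract_trm (Mu (Named 0 u)) (rename_trm u 0 0)"
| S3: "Lam w \<in> named_cmd 0 c \<Longrightarrow>
       contract_trm (Mu c) (Lam (Mu (structsubst_cmd (lift_cmd 0 c) (LVar 0) 0)))"

inductive contract_cmd :: "cmd \<Rightarrow> cmd \<Rightarrow> bool" where
  S1: "contract_cmd (Named a (Mu c)) (rename_cmd c a 0)"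

definition redex_trm :: "trm \<Rightarrow> bool" where
  "redex_trm t \<longleftrightarrow> (\<exists>t'. contract_trm t t')"

definition redex_cmd :: "cmd \<Rightarrow> bool" where
  "redex_cmd c \<longleftrightarrow> (\<exists>c'. contract_cmd c c')"

primrec redex_free_trm :: "trm \<Rightarrow> bool" and redex_free_cmd :: "cmd \<Rightarrow> bool" where
  "redex_free_trm (LVar i) \<longleftrightarrow> True"
| "redex_free_trm (Lam t) \<longleftrightarrow> redex_free_trm t"
| "redex_free_trm (App t u) \<longleftrightarrow>
     \<not> redex_trm (App t u) \<and> redex_free_trm t \<and> redex_free_trm u"
| "redex_free_trm (Mu c) \<longleftrightarrow> \<not> redex_trm (Mu c) \<and> redex_free_cmd c"
| "redex_free_cmd (Named b t) \<longleftrightarrow> \<not> redex_cmd (Named b t) \<and> redex_free_trm t"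

text \<open>Reduction of the leftmost redex, i.e. the one that begins first when the term is read
  from left to right; a redex thus precedes those it contains.  When \<open>S2\<close> and \<open>S3\<close> apply
  to the same \<open>\<mu>\<close>-abstraction, either may be used.\<close>

inductive leftmost_trm :: "trm \<Rightarrow> trm \<Rightarrow> bool" and leftmost_cmd :: "cmd \<Rightarrow> cmd \<Rightarrow> bool" where
  "contract_trm t t' \<Longrightarrow> leftmost_trm t t'"
| "leftmost_trm t t' \<Longrightarrow> leftmost_trm (Lam t) (Lam t')"
| "\<not> redex_trm (App t u) \<Longrightarrow> leftmost_trm t t' \<Longrightarrow> leftmost_trm (App t u) (App t' u)"
| "\<not> redex_trm (App t u) \<Longrightarrow> redex_free_trm t \<Longrightarrow> leftmost_trm u u' \<Longrightarrow>
     leftmost_trm (App t u) (App t u')"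
| "\<not> redex_trm (Mu c) \<Longrightarrow> leftmost_cmd c c' \<Longrightarrow> leftmost_trm (Mu c) (Mu c')"
| "contract_cmd c c' \<Longrightarrow> leftmost_cmd c c'"
| "\<not> redex_cmd (Named b t) \<Longrightarrow> leftmost_trm t t' \<Longrightarrow> leftmost_cmd (Named b t) (Named b t')"

text \<open>\<open>S1\<close> contracts the named term \<open>[\<beta>]u\<close>, not \<open>\<mu>\<alpha>[\<beta>]u\<close> itself; the requirement that
  \<open>\<mu>\<alpha>[\<beta>]u\<close> is not a redex is meant to exclude this case too.\<close>

inductive hnf :: "trm \<Rightarrow> bool" where
  "hnf (LVar i)"
| "hnf u \<Longrightarrow> hnf (Lam u)"
| "hnf u \<Longrightarrow> \<not> redex_trm (App u v) \<Longrightarrow> hnf (App u v)"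
| "hnf u \<Longrightarrow> \<not> redex_trm (Mu (Named b u)) \<Longrightarrow> \<not> redex_cmd (Named b u) \<Longrightarrow>
     hnf (Mu (Named b u))"

definition head_step :: "trm \<Rightarrow> trm \<Rightarrow> bool" where
  "head_step t t' \<longleftrightarrow> \<not> hnf t \<and> leftmost_trm t t'"

abbreviation head_reduces :: "trm \<Rightarrow> trm \<Rightarrow> bool" (infix "\<succ>" 50) where
  "t \<succ> u \<equiv> head_step\<^sup>*\<^sup>* t u"

definition zero_trm :: trm where
  "zero_trm = Lam (Lam (LVar 1))"

text \<open>\<open>\<lambda>n \<lambda>x \<lambda>f (f)((n)x)f\<close>\<close>

definition suc_trm :: trm where
  "suc_trm = Lam (Lam (Lam (App (LVar 0) (App (App (LVar 2) (LVar 1)) (LVar 0)))))"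

text \<open>\<open>\<lambda>x \<lambda>y (x)(s)y\<close>\<close>

definition F_trm :: trm where
  "F_trm = Lam (Lam (App (LVar 1) (App suc_trm (LVar 0))))"

text \<open>\<open>\<lambda>n \<lambda>f (((n)f)F)0\<close>\<close>

definition T2 :: trm where
  "T2 = Lam (Lam (App (App (App (LVar 1) (LVar 0)) F_trm) zero_trm))"

text \<open>No \<open>\<lambda>\<close>-binder occurs in these terms, so the indices \<open>x\<close> and \<open>f\<close> are never shifted.\<close>

inductive_set N :: "nat \<Rightarrow> nat \<Rightarrow> trm set" for x f :: nat where
  "LVar x \<in> N x f"
| "Mu (Named b (LVar x)) \<in> N x f"
| "u \<in> N x f \<Longrightarrow> App (LVar f) u \<in> N x f"
| "u \<in> N x f \<Longrightarrow> Mu (Named b (App (LVar f) u)) \<in> N x f"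

lemma size_named:
  "v \<in> named_trm a t \<Longrightarrow> size v < size t"
  "v \<in> named_cmd a c \<Longrightarrow> size v < size c"
  by (induction t and c arbitrary: a and a) (fastforce split: if_splits)+

text \<open>Only the values on \<open>N x f\<close> matter; outside it, \<open>val\<close> is given the value \<open>{}\<close> wherever
  the defining clauses do not apply.\<close>

function val :: "nat \<Rightarrow> nat \<Rightarrow> trm \<Rightarrow> nat set" where
  "val x f (LVar y) = (if y = x then {0} else {})"
| "val x f (Lam t) = {}"
| "val x f (App t u) = (if t = LVar f then {Suc n | n. n \<in> val x f u} else {})"
| "val x f (Mu c) = (\<Union>v\<in>named_cmd 0 c. val x f v)"
  by pat_completeness auto
termination
  by (relation "measure (\<lambda>(x, f, t). size t)") (auto dest: size_named)

end

theory Submission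
  imports Defs
begin

text \<open>
  Substituting the variable \<open>f\<close> for \<open>x\<close> and \<open>F\<close> for \<open>f\<close> in \<open>u\<close> and applying the result to
  \<open>0\<close> gives a machine whose accumulator is the argument.  Write \<open>v\<^sub>k\<close> for \<open>(s)\<close> applied \<open>k\<close>
  times to \<open>0\<close>; the term \<open>((F)w)v\<^sub>k\<close> head reduces to \<open>(w)v\<^sub>k\<^sub>+\<^sub>1\<close>.  A \<open>\<mu>\<alpha>\<close> that meets the
  accumulator stores its present value at every \<open>[\<alpha>]\<close>, and each later jump to \<open>\<alpha>\<close> resumes
  counting from there.

  Since \<open>u\<close> has no free \<open>\<mu>\<close>-variable, at most one \<open>\<mu>\<close>-abstraction stays pending at the head:
  as soon as a second one arrives, \<open>S1\<close> renames its variable to that of the first.  So the head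
  reduction consists, up to intermediate steps, of two kinds of states, \<open>(w)v\<^sub>k\<close> and
  \<open>\<mu>\<alpha>[\<alpha>](w)v\<^sub>k\<close>, where \<open>w\<close> stems from a subterm of \<open>u\<close> and every jump of \<open>w\<close> out of itself
  has the form \<open>[\<alpha>](t)v\<^sub>e\<close>, with its own stored value \<open>e\<close>.  The function \<open>inst_trm\<close> describes
  these \<open>w\<close> through the original subterm and the environment of stored values.

  The hypothesis on \<open>val\<close> becomes the invariant that the accumulator plus any value of the
  current subterm is \<open>n\<close>, and that the value stored for a \<open>\<mu>\<close>-variable plus any value of a
  subterm named by it is also \<open>n\<close> (\<open>head_reduces_states\<close>).  Counting an \<open>f\<close> and storing at a
  \<open>\<mu>\<close> both pass to a smaller subterm, hence the leaf \<open>x\<close> is reached, whose only value is \<open>0\<close>;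
  there the accumulator is \<open>v\<^sub>n\<close>.  Once the pending \<open>\<mu>\<alpha>\<close>, if any, binds nothing in \<open>w\<close>, \<open>S2\<close>
  removes it.  The rule \<open>S3\<close> never interferes, as the pending variable names no
  \<open>\<lambda>\<close>-abstraction.
\<close>

section \<open>Head steps\<close>

inductive_cases contract_LVarE: "contract_trm (LVar i) s"
inductive_cases contract_LamE: "contract_trm (Lam t) s"
inductive_cases contract_AppE: "contract_trm (App t v) s"
inductive_cases contract_MuE: "contract_trm (Mu c) s"
inductive_cases hnf_AppE: "hnf (App t v)"
inductive_cases hnf_MuE: "hnf (Mu (Named b t))"

lemma redex_App_iff: "redex_trm (App t v) \<longleftrightarrow> (\<exists>w. t = Lam w) \<or> (\<exists>c. t = Mu c)"
  unfolding redex_trm_def by (auto elim: contract_AppE intro: contract_trm.intros)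

lemma head_step_contract:
  assumes "contract_trm t t'" shows "head_step t t'"
proof -
  have "redex_trm t" using assms unfolding redex_trm_def by blast
  moreover have "\<not> redex_trm (LVar i)" "\<not> redex_trm (Lam w)" for i w
    unfolding redex_trm_def by (auto elim: contract_LVarE contract_LamE)
  ultimately have "\<not> hnf t" by (metis hnf.cases)
  then show ?thesis
    unfolding head_step_def using assms by (blast intro: leftmost_trm_leftmost_cmd.intros(1))
qed

lemma head_step_App:
  assumes "head_step t t'" and "\<not> redex_trm (App t v)"
  shows "head_step (App t v) (App t' v)"
  using assms unfolding head_step_def
  by (blast elim: hnf_AppE intro: leftmost_trm_leftmost_cmd.intros(3))

lemma head_step_Mu:
  assumes "head_step t t'" and "\<not> redex_trm (Mu (Named b t))" and "\<And>c. t \<noteq> Mu c"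
  shows "head_step (Mu (Named b t)) (Mu (Named b t'))"
proof -
  have "\<not> redex_cmd (Named b t)"
    using assms(3) unfolding redex_cmd_def by (auto elim: contract_cmd.cases)
  then show ?thesis
    using assms unfolding head_step_def
    by (blast elim: hnf_MuE intro: leftmost_trm_leftmost_cmd.intros(5,7))
qed

lemma head_step_S1:
  assumes "\<not> redex_trm (Mu (Named a (Mu c)))"
  shows "head_step (Mu (Named a (Mu c))) (Mu (rename_cmd c a 0))"
proof -
  have S1: "contract_cmd (Named a (Mu c)) (rename_cmd c a 0)" by (rule contract_cmd.S1)
  then have "redex_cmd (Named a (Mu c))" unfolding redex_cmd_def by blast
  then have "\<not> hnf (Mu (Named a (Mu c)))" by (blast elim: hnf_MuE)
  then show ?thesis
    unfolding head_step_def using S1 assms by (blast intro: leftmost_trm_leftmost_cmd.intros(5,6))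
qed

section \<open>General facts on \<open>\<mu>\<close>-variables\<close>

lemma fmv_Mu_subset: "fmv_trm (Mu c) \<subseteq> {..<d} \<longleftrightarrow> fmv_cmd c \<subseteq> {..<Suc d}"
proof -
  have "(\<forall>b. Suc b \<in> fmv_cmd c \<longrightarrow> b < d) \<longleftrightarrow> (\<forall>b. b \<in> fmv_cmd c \<longrightarrow> b < Suc d)" (is "?L \<longleftrightarrow> ?R")
  proof
    assume ?L
    show ?R
    proof (intro allI impI)
      fix b assume "b \<in> fmv_cmd c"
      then show "b < Suc d" using \<open>?L\<close> by (cases b) auto
    qed
  qed auto
  then show ?thesis by (auto simp: subset_iff)
qed

lemma rename_closed:
  "fmv_trm t \<subseteq> {..<d} \<Longrightarrow> rename_trm t a d = t"
  "fmv_cmd c \<subseteq> {..<d} \<Longrightarrow> rename_cmd c a d = c"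
proof (induction t and c arbitrary: a d and a d)
  case (Mu c)
  then have "fmv_cmd c \<subseteq> {..<Suc d}" by (simp only: fmv_Mu_subset)
  then show ?case using Mu.IH by simp
qed auto

lemma fmv_structsubst:
  "fmv_trm t \<subseteq> fmv_trm (structsubst_trm t v a)"
  "fmv_cmd c \<subseteq> fmv_cmd (structsubst_cmd c v a)"
  by (induction t and c arbitrary: v a and v a) fastforce+

lemma named_imp_fmv:
  "s \<in> named_trm a t \<Longrightarrow> a \<in> fmv_trm t"
  "s \<in> named_cmd a c \<Longrightarrow> a \<in> fmv_cmd c"
  by (induction t and c arbitrary: a and a) (auto split: if_splits)

section \<open>The terms met at the head\<close>

text \<open>The two \<open>\<mu>\<close>-clauses of \<open>N\<close> only differ in the member of \<open>N\<close> that follows \<open>\<mu>\<alpha>[\<beta>]\<close>; a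
  single induction step serves for both.\<close>

lemma N_induct [consumes 1, case_names var app mu]:
  assumes "u \<in> N x f" and "P (LVar x)"
    and "\<And>w. w \<in> N x f \<Longrightarrow> P w \<Longrightarrow> P (App (LVar f) w)"
    and "\<And>b w. w \<in> N x f \<Longrightarrow> Mu (Named b w) \<in> N x f \<Longrightarrow> P w \<Longrightarrow> P (Mu (Named b w))"
  shows "P u"
  using assms(1) by (induction rule: N.induct) (auto intro: assms(2-4) N.intros)

abbreviation acc :: "nat \<Rightarrow> trm" where
  "acc k \<equiv> (App suc_trm ^^ k) zero_trm"

text \<open>The term that an original subterm of \<open>u\<close> has become when it reaches the head.  The
  variable \<open>x\<close> is instantiated by the variable \<open>z\<close>, and \<open>f\<close> by \<open>F\<close>.  The first \<open>d\<close>
  \<open>\<mu>\<close>-indices belong to binders inside the subterm, which are untouched.  All others have been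
  merged into the one pending \<open>\<mu>\<close>-variable, whose index is \<open>d\<close>; the subterms that they name
  are applied to the accumulator \<open>e\<close> that was stored when their binder was met.\<close>

primrec inst_trm :: "nat \<Rightarrow> nat \<Rightarrow> (nat \<Rightarrow> nat) \<Rightarrow> trm \<Rightarrow> trm"
    and inst_cmd :: "nat \<Rightarrow> nat \<Rightarrow> (nat \<Rightarrow> nat) \<Rightarrow> cmd \<Rightarrow> cmd" where
  "inst_trm z d e (LVar i) = LVar z"
| "inst_trm z d e (Lam t) = Lam t"
| "inst_trm z d e (App t w) = App F_trm (inst_trm z d e w)"
| "inst_trm z d e (Mu c) = Mu (inst_cmd z (Suc d) e c)"
| "inst_cmd z d e (Named b w) =
     (if b < d then Named b (inst_trm z d e w)
      else Named d (App (inst_trm z d e w) (acc (e (b - d)))))"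

lemma F_closed [simp]:
  "lift_trm k F_trm = F_trm" "mlift_trm k F_trm = F_trm" "subst_trm F_trm v k = F_trm"
  "rename_trm F_trm a k = F_trm" "structsubst_trm F_trm v a = F_trm"
  "fmv_trm F_trm = {}" "named_trm a F_trm = {}"
  by (simp_all add: F_trm_def suc_trm_def)

lemma suc_closed [simp]:
  "lift_trm k suc_trm = suc_trm" "mlift_trm k suc_trm = suc_trm"
  "subst_trm suc_trm v k = suc_trm"
  "rename_trm suc_trm a k = suc_trm" "structsubst_trm suc_trm v a = suc_trm"
  "fmv_trm suc_trm = {}" "named_trm a suc_trm = {}"
  by (simp_all add: suc_trm_def)

lemma acc_closed [simp]:
  "lift_trm k (acc m) = acc m" "mlift_trm k (acc m) = acc m" "subst_trm (acc m) v k = acc m"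
  "rename_trm (acc m) a k = acc m" "structsubst_trm (acc m) v a = acc m"
  "fmv_trm (acc m) = {}" "named_trm a (acc m) = {}"
  by (induction m) (simp_all add: zero_trm_def)

context
  fixes w :: trm and x f :: nat
  assumes N: "w \<in> N x f"
begin

lemma lift_inst: "k \<le> z \<Longrightarrow> lift_trm k (inst_trm z d e w) = inst_trm (Suc z) d e w"
  using N by (induction arbitrary: d rule: N_induct) auto

lemma subst_inst: "k \<le> z \<Longrightarrow> subst_trm (inst_trm (Suc z) d e w) v k = inst_trm z d e w"
  using N by (induction arbitrary: d v rule: N_induct) auto

lemma fmv_inst: "d \<in> fmv_trm (inst_trm z d e w) \<longleftrightarrow> \<not> fmv_trm w \<subseteq> {..<d}"
  using N
proof (induction arbitrary: d rule: N_induct)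
  case (mu b w)
  have "fmv_trm (Mu (Named b w)) \<subseteq> {..<d} \<longleftrightarrow> b < Suc d \<and> fmv_trm w \<subseteq> {..<Suc d}"
    unfolding fmv_Mu_subset by simp
  then show ?case using mu.IH[of "Suc d"] by auto
qed auto

lemma fmv_inst_le: "a \<in> fmv_trm (inst_trm z d e w) \<Longrightarrow> a \<le> d"
  using N by (induction arbitrary: a d rule: N_induct) (fastforce split: if_splits)+

text \<open>The pending \<open>\<mu>\<close>-variable only names applications, so \<open>S3\<close> does not apply to its binder; the
  second lemma is for the moment between \<open>C2\<close> and the merging \<open>S1\<close>, when the fresh variable
  has index \<open>d\<close> and the pending one \<open>Suc d\<close>.\<close>

lemma no_named_Lam: "Lam s \<notin> named_trm d (inst_trm z d e w)"
  using N by (induction arbitrary: d rule: N_induct) auto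

lemma no_named_Lam_structsubst:
  "Lam s \<notin> named_trm (Suc d) (structsubst_trm (inst_trm z (Suc d) e w) (acc k) d)"
  using N by (induction arbitrary: d rule: N_induct) auto

text \<open>The two ways in which a \<open>\<mu>\<close>-variable becomes the pending one: a \<open>\<mu>\<close>-abstraction that
  meets the accumulator is merged by \<open>S1\<close> with the pending one, or no \<open>\<mu>\<close> is pending and it
  takes this role itself.  In both cases the accumulator is pushed onto the environment.\<close>

lemma rename_structsubst_inst:
  "rename_trm (structsubst_trm (inst_trm z (Suc d) e w) (acc k) d) d d
     = inst_trm z d (case_nat k e) w"
  using N
proof (induction arbitrary: d rule: N_induct)
  case (mu b w)
  have "case_nat k e (b - Suc d) = e (b - Suc (Suc d))" if "Suc d < b"
    using that by (simp add: Suc_diff_Suc[symmetric])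
  then show ?case using mu by auto
qed auto

lemma structsubst_inst:
  "fmv_trm w \<subseteq> {..<Suc d} \<Longrightarrow>
   structsubst_trm (inst_trm z (Suc d) e w) (acc k) d = inst_trm z d (case_nat k e) w"
  using N
proof (induction arbitrary: d rule: N_induct)
  case (mu b w)
  have "fmv_trm w \<subseteq> {..<Suc (Suc d)}" "b < Suc (Suc d)"
    using mu.prems unfolding fmv_Mu_subset by simp_all
  then show ?case using mu.IH[of "Suc d"] by auto
qed auto

end

lemma subst_eq_inst:
  assumes "u \<in> N 1 0" and "fmv_trm u \<subseteq> {..<d}"
  shows "subst_trm (subst_trm u (LVar (Suc z)) 1) F_trm 0 = inst_trm z d e u"
  using assms
proof (induction arbitrary: d rule: N_induct)
  case (mu b w)
  have "fmv_trm w \<subseteq> {..<Suc d}" "b < Suc d"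
    using mu.prems unfolding fmv_Mu_subset by simp_all
  then show ?case using mu.IH[of "Suc d"] by simp
qed auto

lemma lift_N: "u \<in> N x f \<Longrightarrow> x < k \<Longrightarrow> f < k \<Longrightarrow> lift_trm k u = u"
  by (induction rule: N_induct) auto

lemma subst_N: "u \<in> N x f \<Longrightarrow> x < k \<Longrightarrow> f < k \<Longrightarrow> subst_trm u v k = u"
  by (induction arbitrary: v rule: N_induct) auto

section \<open>The run of the head reduction\<close>

abbreviation state :: "nat \<Rightarrow> (nat \<Rightarrow> nat) \<Rightarrow> trm \<Rightarrow> nat \<Rightarrow> trm" where
  "state z e w k \<equiv> App (inst_trm z 0 e w) (acc k)"

lemma state_not_redex_Mu:
  assumes "w \<in> N x f" and "fmv_trm w \<noteq> {}"
  shows "\<not> redex_trm (Mu (Named 0 (state z e w k)))"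
  unfolding redex_trm_def
  using assms fmv_inst[OF assms(1), of 0 z e] no_named_Lam[OF assms(1), of _ 0 z e]
  by (auto elim!: contract_MuE)

lemma head_step_F: "head_step (App F_trm t) (Lam (App (lift_trm 0 t) (App suc_trm (LVar 0))))"
proof -
  have "subst_trm (Lam (App (LVar 1) (App suc_trm (LVar 0)))) t 0
      = Lam (App (lift_trm 0 t) (App suc_trm (LVar 0)))" by simp
  then show ?thesis
    using head_step_contract[OF contract_trm.C1[of "Lam (App (LVar 1) (App suc_trm (LVar 0)))" t]]
    by (simp add: F_trm_def)
qed

lemma contract_count:
  assumes "w \<in> N x f"
  shows "contract_trm (App (Lam (App (lift_trm 0 (inst_trm z d e w)) (App suc_trm (LVar 0)))) (acc k))
           (App (inst_trm z d e w) (acc (Suc k)))"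
proof -
  have "subst_trm (App (lift_trm 0 (inst_trm z d e w)) (App suc_trm (LVar 0))) (acc k) 0
      = App (inst_trm z d e w) (acc (Suc k))"
    using assms by (simp add: lift_inst subst_inst)
  then show ?thesis using contract_trm.C1 by metis
qed

text \<open>Whichever jumps are taken from here on, the run ends with \<open>n\<close> successors.  The condition
  concerns all values and does not ask for one: a subterm that only jumps out of itself has no
  value, and its outcome is controlled by the stored values \<open>e\<close> alone.\<close>

definition balanced :: "nat \<Rightarrow> nat \<Rightarrow> nat \<Rightarrow> (nat \<Rightarrow> nat) \<Rightarrow> trm \<Rightarrow> nat \<Rightarrow> bool" where
  "balanced x f n e w k \<longleftrightarrow> (\<forall>m\<in>val x f w. m + k = n) \<and>
     (\<forall>b. \<forall>t\<in>named_trm b w. \<forall>m\<in>val x f t. m + e b = n)"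

lemma balanced_app: "balanced x f n e (App (LVar f) w) k \<Longrightarrow> balanced x f n e w (Suc k)"
  by (auto simp: balanced_def)

text \<open>Here the definition of \<open>val\<close> on a \<open>\<mu>\<close>-abstraction enters: the values of \<open>\<mu>\<alpha> c\<close> are those
  of the subterms of \<open>c\<close> named \<open>\<alpha>\<close>, and these are the subterms that resume from \<open>k\<close> when the
  accumulator is pushed.\<close>

lemma balanced_mu:
  assumes "balanced x f n e (Mu (Named b w)) k"
  shows "balanced x f n (case_nat k e) w (case_nat k e b)"
proof -
  have 0: "m + k = n" if "t \<in> named_cmd 0 (Named b w)" "m \<in> val x f t" for t m
    using assms that unfolding balanced_def by auto
  have Suc: "m + e a = n" if "t \<in> named_cmd (Suc a) (Named b w)" "m \<in> val x f t" for a t m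
    using assms that unfolding balanced_def by auto
  have *: "m + case_nat k e a = n" if "t \<in> named_cmd a (Named b w)" "m \<in> val x f t" for a t m
    using that 0 Suc by (cases a) (simp_all del: named_cmd.simps)
  show ?thesis unfolding balanced_def
  proof (intro conjI allI ballI)
    fix m assume "m \<in> val x f w"
    then show "m + case_nat k e b = n" using *[of w b m] by simp
  next
    fix a t m assume "t \<in> named_trm a w" "m \<in> val x f t"
    then show "m + case_nat k e a = n" using *[of t a m] by simp
  qed
qed

text \<open>As long as \<open>w\<close> has free \<open>\<mu>\<close>-variables the pending \<open>\<mu>\<close> is not a redex and the reduction
  goes on below it; once \<open>w\<close> has none, \<open>S2\<close> drops it at once.\<close>

lemma head_reduces_states:
  assumes "w \<in> N x f" and "balanced x f n e w k"
  shows "(fmv_trm w = {} \<longrightarrow> state z e w k \<succ> App (LVar z) (acc n)) \<and>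
         Mu (Named 0 (state z e w k)) \<succ> App (LVar z) (acc n)"
proof -
  have drop: "head_step (Mu (Named 0 (state z e w k))) (state z e w k)"
    if "w \<in> N x f" "fmv_trm w = {}" for w e k
  proof -
    have "fmv_trm (inst_trm z 0 e w) = {}"
      using that fmv_inst fmv_inst_le by blast
    then show ?thesis
      using head_step_contract[OF contract_trm.S2[of "state z e w k"]] rename_closed(1)[of _ 0 0]
      by simp
  qed
  have drop': "Mu (Named 0 (state z e w k)) \<succ> t"
    if "w \<in> N x f" "fmv_trm w = {}" "state z e w k \<succ> t" for w e k t
    using drop[OF that(1,2)] that(3) by (rule converse_rtranclp_into_rtranclp)
  show ?thesis using assms
  proof (induction arbitrary: e k rule: N_induct)
    case var
    then have "state z e (LVar x) k = App (LVar z) (acc n)" by (simp add: balanced_def)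
    then show ?case using drop'[OF N.intros(1)] by (metis fmv_trm.simps(1) rtranclp.rtrancl_refl)
  next
    case (app w)
    have N: "App (LVar f) w \<in> N x f" using app.hyps by (rule N.intros)
    let ?r = "inst_trm z 0 e w"
    \<comment> \<open>Counting one \<open>f\<close> takes two steps, with \<open>F\<close> half applied in between.\<close>
    let ?mid = "App (Lam (App (lift_trm 0 ?r) (App suc_trm (LVar 0)))) (acc k)"
    have IH: "(fmv_trm w = {} \<longrightarrow> state z e w (Suc k) \<succ> App (LVar z) (acc n)) \<and>
         Mu (Named 0 (state z e w (Suc k))) \<succ> App (LVar z) (acc n)"
      using app.IH balanced_app[OF app.prems] .
    have 1: "head_step (state z e (App (LVar f) w) k) ?mid"
      using head_step_App[OF head_step_F] by (simp add: redex_App_iff F_trm_def)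
    have 2: "head_step ?mid (state z e w (Suc k))"
      using app.hyps by (intro head_step_contract contract_count)
    have A: "state z e (App (LVar f) w) k \<succ> App (LVar z) (acc n)" if "fmv_trm w = {}"
      using 1 2 IH that by (meson converse_rtranclp_into_rtranclp)
    have B: "Mu (Named 0 (state z e (App (LVar f) w) k)) \<succ> App (LVar z) (acc n)"
      if ne: "fmv_trm w \<noteq> {}"
    proof -
      have "\<not> redex_trm (Mu (Named 0 (state z e (App (LVar f) w) k)))"
        using state_not_redex_Mu[OF N] ne by simp
      then have "head_step (Mu (Named 0 (state z e (App (LVar f) w) k))) (Mu (Named 0 ?mid))"
        using 1 by (intro head_step_Mu) auto
      moreover have "\<not> redex_trm (Mu (Named 0 ?mid))"
        using ne fmv_inst[OF app.hyps(1), of 0 "Suc z" e]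
          no_named_Lam[OF app.hyps(1), of _ 0 "Suc z" e]
        unfolding redex_trm_def by (auto elim!: contract_MuE simp: lift_inst[OF app.hyps(1)])
      then have "head_step (Mu (Named 0 ?mid)) (Mu (Named 0 (state z e w (Suc k))))"
        using 2 by (intro head_step_Mu) auto
      ultimately show ?thesis
        using IH by (meson converse_rtranclp_into_rtranclp)
    qed
    show ?case using A B drop'[OF N] by auto
  next
    case (mu b w)
    let ?u = "Mu (Named b w)"
    let ?e = "case_nat k e"
    let ?c = "structsubst_cmd (inst_cmd z (Suc 0) e (Named b w)) (acc k) 0"
    have IH: "Mu (Named 0 (state z ?e w (?e b))) \<succ> App (LVar z) (acc n)"
      using mu.IH balanced_mu[OF mu.prems] by blast
    have push: "contract_trm (state z e ?u k) (Mu ?c)"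
      using contract_trm.C2[of "inst_cmd z (Suc 0) e (Named b w)" "acc k"] by simp
    have A: "state z e ?u k \<succ> App (LVar z) (acc n)" if "fmv_trm ?u = {}"
    proof -
      have "fmv_cmd (Named b w) \<subseteq> {..<Suc 0}"
        using fmv_Mu_subset[of "Named b w" 0] that by simp
      then have "b = 0" "fmv_trm w \<subseteq> {..<Suc 0}" by auto
      then have "Mu ?c = Mu (Named 0 (state z ?e w (?e b)))"
        using structsubst_inst[OF mu.hyps(1), of 0 z e k] by simp
      then show ?thesis
        using head_step_contract[OF push] IH by (metis converse_rtranclp_into_rtranclp)
    qed
    have B: "Mu (Named 0 (state z e ?u k)) \<succ> App (LVar z) (acc n)"
      if ne: "fmv_trm ?u \<noteq> {}"
    proof -
      note N = mu.hyps(2)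
      have fmv: "0 \<in> fmv_trm (inst_trm z 0 e ?u)"
        using fmv_inst[OF N] ne by blast
      have "\<not> redex_trm (Mu (Named 0 (state z e ?u k)))"
        using N ne by (rule state_not_redex_Mu)
      then have 1: "head_step (Mu (Named 0 (state z e ?u k))) (Mu (Named 0 (Mu ?c)))"
        using head_step_contract[OF push] by (intro head_step_Mu) auto
      have "0 \<in> fmv_trm (Mu ?c)"
        using fmv fmv_structsubst(2)[of "inst_cmd z (Suc 0) e (Named b w)" "acc k" 0] by auto
      moreover have "Lam s \<notin> named_trm 0 (Mu ?c)" for s
        using no_named_Lam_structsubst[OF mu.hyps(1)] by simp
      ultimately have "\<not> redex_trm (Mu (Named 0 (Mu ?c)))"
        unfolding redex_trm_def by (auto elim!: contract_MuE)
      then have "head_step (Mu (Named 0 (Mu ?c))) (Mu (rename_cmd ?c 0 0))"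
        by (rule head_step_S1)
      moreover have "rename_cmd ?c 0 0 = Named 0 (state z ?e w (?e b))"
        using rename_structsubst_inst[OF mu.hyps(1), of z 0 e k] by (cases b) simp_all
      ultimately show ?thesis
        using 1 IH by (metis converse_rtranclp_into_rtranclp)
    qed
    show ?case using A B drop'[OF mu.hyps(2)] by blast
  qed
qed

theorem mainTheorem4:
  fixes u :: trm and n f :: nat
  assumes "u \<in> N 1 0"
    and "fmv_trm u = {}"
    and "val 1 0 u = {n}"
  shows "App (App T2 (Lam (Lam u))) (LVar f) \<succ> App (LVar f) ((App suc_trm ^^ n) zero_trm)"
proof -
  let ?\<theta> = "Lam (Lam u)"
  let ?v = "subst_trm u (LVar (Suc f)) 1"
  have lift: "lift_trm k u = u" if "1 < k" for k
    using lift_N[OF assms(1), of k] that by simp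
  have "contract_trm (App T2 ?\<theta>) (Lam (App (App (App ?\<theta> (LVar 0)) F_trm) zero_trm))"
  proof -
    have "subst_trm (Lam (App (App (App (LVar 1) (LVar 0)) F_trm) zero_trm)) ?\<theta> 0
        = Lam (App (App (App ?\<theta> (LVar 0)) F_trm) zero_trm)"
      by (simp add: lift zero_trm_def)
    then show ?thesis unfolding T2_def using contract_trm.C1 by metis
  qed
  then have 1: "head_step (App (App T2 ?\<theta>) (LVar f))
      (App (Lam (App (App (App ?\<theta> (LVar 0)) F_trm) zero_trm)) (LVar f))"
    by (intro head_step_App head_step_contract) (auto simp: redex_App_iff T2_def)
  have "contract_trm (App (Lam (App (App (App ?\<theta> (LVar 0)) F_trm) zero_trm)) (LVar f))
      (App (App (App ?\<theta> (LVar f)) F_trm) zero_trm)"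
  proof -
    have "subst_trm (App (App (App ?\<theta> (LVar 0)) F_trm) zero_trm) (LVar f) 0
        = App (App (App ?\<theta> (LVar f)) F_trm) zero_trm"
      using subst_N[OF assms(1)] by (simp add: zero_trm_def)
    then show ?thesis using contract_trm.C1 by metis
  qed
  then have 2: "head_step (App (Lam (App (App (App ?\<theta> (LVar 0)) F_trm) zero_trm)) (LVar f))
      (App (App (App ?\<theta> (LVar f)) F_trm) zero_trm)"
    by (rule head_step_contract)
  have "contract_trm (App ?\<theta> (LVar f)) (Lam ?v)"
    using contract_trm.C1[of "Lam u" "LVar f"] by simp
  then have 3: "head_step (App (App (App ?\<theta> (LVar f)) F_trm) zero_trm)
      (App (App (Lam ?v) F_trm) zero_trm)"
    by (intro head_step_App head_step_contract) (auto simp: redex_App_iff)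
  have 4: "head_step (App (App (Lam ?v) F_trm) zero_trm) (state f e u 0)" for e
  proof -
    have "contract_trm (App (Lam ?v) F_trm) (inst_trm f 0 e u)"
      using contract_trm.C1[of ?v F_trm] subst_eq_inst[OF assms(1), of 0 f e] assms(2) by simp
    then have "head_step (App (Lam ?v) F_trm) (inst_trm f 0 e u)" by (rule head_step_contract)
    then show ?thesis
      using head_step_App[of _ _ "acc 0"] by (simp add: redex_App_iff)
  qed
  have "named_trm b u = {}" for b
    using named_imp_fmv(1)[of _ b u] assms(2) by blast
  then have "balanced 1 0 n e u 0" for e
    using assms(3) by (simp add: balanced_def)
  then have "state f e u 0 \<succ> App (LVar f) (acc n)" for e
    using head_reduces_states[OF assms(1)] assms(2) by blast
  then show ?thesis using 1 2 3 4 by (meson converse_rtranclp_into_rtranclp)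
qed

end
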